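(* Let $d\ge 1$ and let $G$ be a finite $d$-regular graph containing no cycle of length $4$. If $G$ has at least $d^3+d$ vertices, then $b(G)=d+1$.
   Context: A $b$-coloring of a graph $G$ is a proper vertex coloring such that every color class contains a vertex (called dominant) adjacent to at least one vertex of each of the other color classes. The $b$-chromatic number $b(G)$ is the largest integer $k$ such that $G$ admits a $b$-coloring with $k$ colors. (For any graph, $b(G)\le \Delta(G)+1$.) *)

theory Defs
  imports "Graph_Theory.Graph_Theory"
begin

text \<open>
  Finite simple graphs are represented by the locale \<^locale>\<open>graph\<close>: finite, loop-free
  digraphs without parallel arcs whose adjacency relation is symmetric. An undirected edge is
  therefore a pair of opposite arcs, and the degree of a vertex is its out-degree.
\<close>

definition regular :: "nat \<Rightarrow> ('a, 'b) pre_digraph \<Rightarrow> bool" where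
  "regular d G \<longleftrightarrow> (\<forall>v \<in> verts G. out_degree G v = d)"

text \<open>
  For length at least 3, the directed cycles of a symmetric digraph are exactly the oriented
  traversals of the cycles of the underlying undirected graph (only length 2 is degenerate).
\<close>

definition has_cycle_of_length :: "nat \<Rightarrow> ('a, 'b) pre_digraph \<Rightarrow> bool" where
  "has_cycle_of_length n G \<longleftrightarrow> (\<exists>p. pre_digraph.cycle G p \<and> length p = n)"

definition proper_coloring :: "('a, 'b) pre_digraph \<Rightarrow> nat \<Rightarrow> ('a \<Rightarrow> nat) \<Rightarrow> bool" where
  "proper_coloring G k c \<longleftrightarrow>
     (\<forall>v \<in> verts G. c v < k) \<and> (\<forall>u v. u \<rightarrow>\<^bsub>G\<^esub> v \<longrightarrow> c u \<noteq> c v)"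

definition color_class :: "('a, 'b) pre_digraph \<Rightarrow> ('a \<Rightarrow> nat) \<Rightarrow> nat \<Rightarrow> 'a set" where
  "color_class G c i = {v \<in> verts G. c v = i}"

definition dominant :: "('a, 'b) pre_digraph \<Rightarrow> nat \<Rightarrow> ('a \<Rightarrow> nat) \<Rightarrow> 'a \<Rightarrow> bool" where
  "dominant G k c v \<longleftrightarrow>
     (\<forall>j < k. j \<noteq> c v \<longrightarrow> (\<exists>w \<in> color_class G c j. v \<rightarrow>\<^bsub>G\<^esub> w))"

text \<open>
  Every one of the \<open>k\<close> colors is used, since each color class contains a dominant vertex.
\<close>

definition b_coloring :: "('a, 'b) pre_digraph \<Rightarrow> nat \<Rightarrow> ('a \<Rightarrow> nat) \<Rightarrow> bool" where
  "b_coloring G k c \<longleftrightarrow>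
     proper_coloring G k c \<and> (\<forall>i < k. \<exists>v \<in> color_class G c i. dominant G k c v)"

text \<open>
  On a finite graph the maximum exists: a proper coloring with the fewest colors is a b-coloring,
  and a b-coloring uses at most as many colors as there are vertices.
\<close>

definition b_chromatic_number :: "('a, 'b) pre_digraph \<Rightarrow> nat" where
  "b_chromatic_number G = (GREATEST k. \<exists>c. b_coloring G k c)"

end

theory Submission
  imports Defs
begin

text \<open>
  Choose vertices \<open>x\<^sub>0, \<dots>, x\<^sub>d\<close> one at a time, giving \<open>x\<^sub>j\<close> the color \<open>j\<close> and its neighbors all
  the other colors; the rest of the graph is then colored greedily. Let \<open>S\<close> be the union of the
  first \<open>i\<close> closed neighborhoods. A vertex \<open>v\<close> outside \<open>S\<close> without neighbors of color \<open>i\<close> can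
  be the next one as soon as the weight \<open>(d - 1) p(v) + q(v)\<close> is less than \<open>2 (d - 1)\<close>, where \<open>p(v)\<close>
  is the number of its neighbors in \<open>S\<close> and \<open>q(v)\<close> the number of edges from its other
  neighbors to vertices of \<open>S\<close> with a color other than \<open>i\<close>: since there are no 4-cycles, the
  relation "\<open>y\<close> may not receive the color \<open>k\<close>" is then sparse enough to be avoided by a bijection.
  Double counting shows that the average weight is small enough if the graph has more than
  \<open>|S| + i (d - 1) + i (d - 1)\<^sup>2\<close> vertices. For \<open>i = d\<close> the bound \<open>d\<^sup>3 + d\<close> leaves no room if
  \<open>|S| = d (d + 1)\<close>, so \<open>x\<^sub>1\<close> is chosen at distance 2 from \<open>x\<^sub>0\<close> to save one vertex. This
  needs \<open>d \<ge> 3\<close>; degrees 1 and 2 are colored by hand.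
\<close>

subsection \<open>Bijections avoiding a relation\<close>

text \<open>Induction on the size: a row \<open>a\<close> that contains a conflict is not full, so
  \<open>a\<close> can be matched with a free \<open>b\<close>. Deleting row \<open>a\<close> and
  column \<open>b\<close> removes at least one conflict, which preserves the bound.\<close>

lemma bij_avoiding_few:
  assumes "finite A" "finite B" "card A = card B" "R \<subseteq> A \<times> B" "card R < card A"
  shows "\<exists>f. bij_betw f A B \<and> (\<forall>a\<in>A. (a, f a) \<notin> R)"
  using assms
proof (induction "card A" arbitrary: A B R)
  case 0
  then show ?case by simp
next
  case (Suc n)
  have finR: "finite R" using Suc.prems by (meson finite_SigmaI finite_subset)
  show ?case
  proof (cases "R = {}")
    case True
    with Suc.prems show ?thesis by (metis finite_same_card_bij empty_iff)
  next
    case False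
    then obtain a b0 where ab: "(a, b0) \<in> R" by auto
    have aA: "a \<in> A" using ab Suc.prems by auto
    have "\<exists>b\<in>B. (a, b) \<notin> R"
    proof (rule ccontr)
      assume "\<not> ?thesis"
      then have "Pair a ` B \<subseteq> R" by auto
      then have "card (Pair a ` B) \<le> card R" using finR card_mono by blast
      moreover have "card (Pair a ` B) = card B" by (simp add: card_image inj_on_def)
      ultimately show False using Suc.prems by simp
    qed
    then obtain b where b: "b \<in> B" "(a, b) \<notin> R" by auto
    define R' where "R' = R \<inter> ((A - {a}) \<times> (B - {b}))"
    have "R' \<subseteq> R - {(a, b0)}" by (auto simp: R'_def)
    then have "card R' \<le> card R - 1"
      using ab finR by (metis card_Diff_singleton card_mono finite_Diff)
    moreover have "card R > 0" using ab finR card_gt_0_iff by blast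
    moreover have cA: "card (A - {a}) = n" "card (B - {b}) = n"
      using Suc.hyps(2) Suc.prems aA b by auto
    ultimately have "card R' < card (A - {a})" using Suc.prems Suc.hyps(2) by linarith
    then obtain f where f: "bij_betw f (A - {a}) (B - {b})" "\<forall>x\<in>A - {a}. (x, f x) \<notin> R'"
      using Suc.hyps(1)[of "A - {a}" "B - {b}" R'] cA Suc.prems by (auto simp: R'_def)
    let ?g = "f(a := b)"
    have "bij_betw ?g (A - {a}) (B - {b})" using f(1) by (subst bij_betw_cong[where g = f]) auto
    then have "bij_betw ?g (A - {a} \<union> {a}) (B - {b} \<union> {b})"
      by (intro bij_betw_combine) auto
    moreover have "A - {a} \<union> {a} = A" "B - {b} \<union> {b} = B" using aA b by auto
    moreover have "(x, ?g x) \<notin> R" if "x \<in> A" for x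
    proof (cases "x = a")
      case False
      then have "f x \<in> B - {b}" using f(1) that by (auto simp: bij_betw_def)
      then show ?thesis using f(2) that False by (auto simp: R'_def)
    qed (use b in simp)
    ultimately show ?thesis by auto
  qed
qed

lemma bij_avoiding_local:
  assumes fin: "finite A" "finite B" and card: "card A = card B"
    and sum: "\<And>a b. a \<in> A \<Longrightarrow> b \<in> B \<Longrightarrow> (a, b) \<in> R \<Longrightarrow>
      card {b' \<in> B. (a, b') \<in> R} + card {a' \<in> A. (a', b) \<in> R} \<le> card A"
  shows "\<exists>f. bij_betw f A B \<and> (\<forall>a\<in>A. (a, f a) \<notin> R)"
proof -
  \<comment> \<open>A bijection with the fewest conflicts has none: a conflict could be removed by a swap.\<close>
  define bad where "bad f = {a \<in> A. (a, f a) \<in> R}" for f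
  obtain f0 where "bij_betw f0 A B" using finite_same_card_bij fin card by blast
  then obtain f where f: "bij_betw f A B"
    and min: "\<And>g. bij_betw g A B \<Longrightarrow> card (bad f) \<le> card (bad g)"
    using ex_has_least_nat[of "\<lambda>f. bij_betw f A B" f0 "\<lambda>f. card (bad f)"] by auto
  have finbad: "finite (bad g)" for g using fin by (simp add: bad_def)
  have "bad f = {}"
  proof (rule ccontr)
    assume "bad f \<noteq> {}"
    then obtain a where a: "a \<in> A" "(a, f a) \<in> R" by (auto simp: bad_def)
    \<comment> \<open>\<open>?T1\<close> collects the points whose value is forbidden for
      \<open>a\<close>, \<open>?T2\<close> those for which the value \<open>f a\<close> is
      forbidden. Both contain \<open>a\<close>, so their union misses some \<open>a'\<close>, and
      exchanging the values of \<open>a\<close> and \<open>a'\<close> removes a conflict without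
      creating one.\<close>
    let ?T1 = "{a' \<in> A. (a, f a') \<in> R}" and ?T2 = "{a' \<in> A. (a', f a) \<in> R}"
    have fa: "f a \<in> B" using f a by (auto simp: bij_betw_def)
    have "inj_on f ?T1" using f by (auto simp: bij_betw_def inj_on_def)
    then have "card ?T1 = card (f ` ?T1)" by (simp add: card_image)
    also have "\<dots> \<le> card {b' \<in> B. (a, b') \<in> R}"
      using f fin by (intro card_mono) (auto simp: bij_betw_def)
    finally have "card ?T1 + card ?T2 \<le> card A" using sum[OF a(1) fa a(2)] by linarith
    moreover have "card ?T1 + card ?T2 = card (?T1 \<union> ?T2) + card (?T1 \<inter> ?T2)"
      using fin by (intro card_Un_Int) auto
    moreover have "card (?T1 \<inter> ?T2) > 0"
    proof -
      have "a \<in> ?T1 \<inter> ?T2" using a by auto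
      moreover have "finite (?T1 \<inter> ?T2)" using fin by simp
      ultimately show ?thesis using card_gt_0_iff by blast
    qed
    ultimately have "card (?T1 \<union> ?T2) < card A" by linarith
    then have "\<not> A \<subseteq> ?T1 \<union> ?T2"
      using fin card_mono[of "?T1 \<union> ?T2" A] by auto
    then obtain a' where a': "a' \<in> A" "(a, f a') \<notin> R" "(a', f a) \<notin> R" by auto
    let ?g = "f \<circ> Transposition.transpose a a'"
    have "bij_betw (Transposition.transpose a a') A A"
      using a a' by (auto simp: bij_betw_def inj_on_def image_iff Transposition.transpose_def)
    then have g: "bij_betw ?g A B" using f by (rule bij_betw_trans)
    have "bad ?g \<subset> bad f"
      using a a' by (auto simp: bad_def Transposition.transpose_def split: if_splits)
    then have "card (bad ?g) < card (bad f)" using finbad by (simp add: psubset_card_mono)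
    then show False using min[OF g] by simp
  qed
  then show ?thesis using f by (auto simp: bad_def)
qed

text \<open>A full row or column blocks every bijection. Once these are excluded, almost twice as
  many conflicts are tolerable as in \<open>bij_avoiding_few\<close>.\<close>

lemma bij_avoiding_no_full_line:
  assumes fin: "finite A" "finite B" and card: "card A = card B" and R: "R \<subseteq> A \<times> B"
    and few: "card R + 2 < 2 * card A"
    and row: "\<And>a. a \<in> A \<Longrightarrow> \<exists>b\<in>B. (a, b) \<notin> R"
    and col: "\<And>b. b \<in> B \<Longrightarrow> \<exists>a\<in>A. (a, b) \<notin> R"
  shows "\<exists>f. bij_betw f A B \<and> (\<forall>a\<in>A. (a, f a) \<notin> R)"
proof (cases "\<exists>a\<in>A. \<exists>b\<in>B. (a, b) \<in> R \<and>
    card {b' \<in> B. (a, b') \<in> R} + card {a' \<in> A. (a', b) \<in> R} > card A")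
  case False
  then show ?thesis by (intro bij_avoiding_local fin card) (meson not_le)
next
  case True
  then obtain a b where ab: "a \<in> A" "b \<in> B" "(a, b) \<in> R"
    and big: "card {b' \<in> B. (a, b') \<in> R} + card {a' \<in> A. (a', b) \<in> R} > card A" by auto
  obtain b' where b': "b' \<in> B" "(a, b') \<notin> R" using row ab by auto
  obtain a' where a': "a' \<in> A" "(a', b) \<notin> R" using col ab by auto
  \<comment> \<open>The row of \<open>a\<close> and the column of \<open>b\<close> hold so many conflicts that matching \<open>a\<close> with \<open>b'\<close>
    and \<open>a'\<close> with \<open>b\<close> leaves few enough for \<open>bij_avoiding_few\<close>.\<close>
  have ne: "a \<noteq> a'" "b \<noteq> b'" using ab a' b' by auto
  define A' B' where "A' = A - {a, a'}" and "B' = B - {b, b'}"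
  define R' where "R' = R \<inter> (A' \<times> B')"
  have finR: "finite R" using R fin by (meson finite_SigmaI finite_subset)
  let ?P = "Pair a ` {b' \<in> B. (a, b') \<in> R}" and ?Q = "(\<lambda>x. (x, b)) ` {a' \<in> A. (a', b) \<in> R}"
  have cP: "card ?P = card {b' \<in> B. (a, b') \<in> R}" by (simp add: card_image inj_on_def)
  have cQ: "card ?Q = card {a' \<in> A. (a', b) \<in> R}" by (simp add: card_image inj_on_def)
  \<comment> \<open>The row and the column share only \<open>(a, b)\<close>, so together they hold
    at least \<open>card A\<close> conflicts. None of these lies in \<open>A' \<times> B'\<close>,
    which leaves fewer than \<open>card A - 2\<close> there.\<close>
  have "card ?P + card ?Q = card (?P \<union> ?Q) + card (?P \<inter> ?Q)"
    using fin by (intro card_Un_Int) auto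
  moreover have "?P \<inter> ?Q \<subseteq> {(a, b)}" by auto
  then have "card (?P \<inter> ?Q) \<le> 1" using card_mono[of "{(a, b)}"] by simp
  ultimately have PQ: "card (?P \<union> ?Q) \<ge> card A" using big cP cQ by linarith
  have "card (?P \<union> ?Q) + card R' = card ((?P \<union> ?Q) \<union> R')"
    using finR fin by (intro card_Un_disjoint[symmetric]) (auto simp: R'_def A'_def B'_def)
  also have "\<dots> \<le> card R" using finR by (intro card_mono) (auto simp: R'_def)
  finally have "card R' + 2 < card A" using PQ few by linarith
  moreover have cA: "card A' = card A - 2" "card B' = card B - 2"
    using ab a' b' ne fin by (auto simp: A'_def B'_def card_Diff_subset)
  ultimately have "card R' < card A'" by linarith
  then obtain f where f: "bij_betw f A' B'" "\<forall>x\<in>A'. (x, f x) \<notin> R'"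
    using bij_avoiding_few[of A' B' R'] fin cA card by (auto simp: R'_def A'_def B'_def)
  let ?g = "f(a := b', a' := b)"
  have "bij_betw ?g A' B'" using f(1) by (subst bij_betw_cong[where g = f]) (auto simp: A'_def)
  moreover have "bij_betw ?g {a, a'} {b, b'}" using ne by (auto simp: bij_betw_def inj_on_def)
  ultimately have "bij_betw ?g (A' \<union> {a, a'}) (B' \<union> {b, b'})"
    by (intro bij_betw_combine) (auto simp: B'_def)
  moreover have "A' \<union> {a, a'} = A" "B' \<union> {b, b'} = B"
    using ab a' b' by (auto simp: A'_def B'_def)
  ultimately have "bij_betw ?g A B" by metis
  moreover have "(x, ?g x) \<notin> R" if "x \<in> A" for x
  proof (cases "x \<in> A'")
    case True
    then have "f x \<in> B'" using f(1) by (auto simp: bij_betw_def)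
    then show ?thesis using f(2) True by (auto simp: R'_def A'_def)
  qed (use that a' b' ne in \<open>auto simp: A'_def\<close>)
  ultimately show ?thesis by blast
qed

subsection \<open>Partial colorings with dominating stars\<close>

text \<open>Absence of 4-cycles takes the form in which it is applied: distinct vertices have at
  most one common neighbor.\<close>

locale c4_free_regular =
  fixes V :: "'a set" and E :: "'a \<Rightarrow> 'a \<Rightarrow> bool" and d :: nat
  assumes finite_V: "finite V"
    and E_in_V: "E u v \<Longrightarrow> u \<in> V"
    and E_sym: "E u v \<Longrightarrow> E v u"
    and E_irrefl: "\<not> E v v"
    and degree: "v \<in> V \<Longrightarrow> card {w. E v w} = d"
    and no_C4: "E u a \<Longrightarrow> E a v \<Longrightarrow> E u b \<Longrightarrow> E b v \<Longrightarrow> u \<noteq> v \<Longrightarrow> a = b"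
begin

definition N :: "'a \<Rightarrow> 'a set" where
  "N v = {w. E v w}"

lemma mem_N [simp]: "w \<in> N v \<longleftrightarrow> E v w"
  by (simp add: N_def)

lemma E_in_V2: "E u v \<Longrightarrow> v \<in> V"
  using E_in_V E_sym by blast

lemma N_subset_V: "N v \<subseteq> V"
  using E_in_V2 by auto

lemma finite_N [simp]: "finite (N v)"
  using N_subset_V finite_V finite_subset by blast

lemma finite_N_Collect [simp]: "finite {w. E v w \<and> Q w}"
  using finite_N by (rule rev_finite_subset) auto

lemma card_N: "v \<in> V \<Longrightarrow> card (N v) = d"
  using degree by (simp add: N_def)

lemma card_common_N: "u \<noteq> v \<Longrightarrow> card (N u \<inter> N v) \<le> 1"
  using no_C4[of u _ v] E_sym by (auto simp: card_le_Suc0_iff_eq)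

text \<open>Double counting of the edges between \<open>A\<close> and \<open>B\<close>, each
  weighted by \<open>f\<close> at its end in \<open>A\<close>.\<close>

lemma sum_card_N:
  assumes "finite A" "finite B"
  shows "(\<Sum>a\<in>A. f a * card (N a \<inter> B)) = (\<Sum>b\<in>B. \<Sum>a\<in>N b \<inter> A. f a)"
proof -
  have "f a * card (N a \<inter> B) = (\<Sum>b\<in>B. if E b a then f a else 0)" for a
  proof -
    have "N a \<inter> B = {b \<in> B. E b a}" using E_sym by auto
    then show ?thesis using assms by (simp add: sum.If_cases Int_def mult.commute)
  qed
  then have "(\<Sum>a\<in>A. f a * card (N a \<inter> B)) = (\<Sum>b\<in>B. \<Sum>a\<in>A. if E b a then f a else 0)"
    using sum.swap by simp
  also have "\<dots> = (\<Sum>b\<in>B. \<Sum>a\<in>N b \<inter> A. f a)"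
  proof (rule sum.cong)
    fix b
    have "N b \<inter> A = A \<inter> {a. E b a}" by auto
    then show "(\<Sum>a\<in>A. if E b a then f a else 0) = (\<Sum>a\<in>N b \<inter> A. f a)"
      using assms by (simp add: sum.If_cases)
  qed simp
  finally show ?thesis .
qed

section \<open>Partial colorings and their greedy extension\<close>

definition proper_on :: "'a set \<Rightarrow> ('a \<Rightarrow> nat) \<Rightarrow> bool" where
  "proper_on S c \<longleftrightarrow> (\<forall>u\<in>S. c u \<le> d) \<and> (\<forall>u\<in>S. \<forall>v\<in>S. E u v \<longrightarrow> c u \<noteq> c v)"

text \<open>Greedy coloring: the \<open>d\<close> neighbors of an uncolored vertex block at most
  \<open>d\<close> of the \<open>d + 1\<close> colors.\<close>

lemma proper_on_extend:
  assumes "S \<subseteq> V" "proper_on S c"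
  shows "\<exists>c'. proper_on V c' \<and> (\<forall>u\<in>S. c' u = c u)"
  using assms
proof (induction "card (V - S)" arbitrary: S c)
  case 0
  then have "S = V" using finite_V by auto
  then show ?case using 0 by auto
next
  case (Suc n)
  then have "V - S \<noteq> {}" by (metis card.empty nat.distinct(1))
  then obtain v where v: "v \<in> V" "v \<notin> S" by auto
  have "card (c ` (N v \<inter> S)) \<le> d"
    using card_N[OF v(1)] by (meson card_image_le card_mono finite_Int finite_N inf_le1 le_trans)
  then have "\<not> {..d} \<subseteq> c ` (N v \<inter> S)"
    using card_mono[of "c ` (N v \<inter> S)" "{..d}"] by auto
  then obtain k where k: "k \<le> d" "k \<notin> c ` (N v \<inter> S)" by auto
  let ?c = "c(v := k)"
  have "proper_on (insert v S) ?c"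
    using Suc.prems k v E_sym E_irrefl unfolding proper_on_def by (auto simp: image_iff)
  moreover have "n = card (V - insert v S)"
  proof -
    have "V - insert v S = (V - S) - {v}" by auto
    then show ?thesis using v Suc.hyps(2) finite_V by simp
  qed
  ultimately obtain c' where "proper_on V c'" "\<forall>u\<in>insert v S. c' u = ?c u"
    using Suc.hyps(1)[of "insert v S" ?c] v Suc.prems by auto
  moreover from this have "\<forall>u\<in>S. c' u = c u" using v by auto
  ultimately show ?case by blast
qed

text \<open>For a vertex of degree \<open>d\<close> and \<open>i \<le> d\<close>, the equation
  forces each other color to occur exactly once among the neighbors.\<close>

definition sees_all_colors :: "('a \<Rightarrow> nat) \<Rightarrow> 'a \<Rightarrow> nat \<Rightarrow> bool" where
  "sees_all_colors c v i \<longleftrightarrow> c v = i \<and> c ` N v = {..d} - {i}"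

text \<open>Domination depends only on the closed neighborhood, so it survives any extension of the
  coloring.\<close>

lemma b_coloring_of_partial:
  assumes "S \<subseteq> V" "proper_on S c"
    and "\<And>i. i \<le> d \<Longrightarrow> \<exists>v. insert v (N v) \<subseteq> S \<and> sees_all_colors c v i"
  shows "\<exists>c. proper_on V c \<and> (\<forall>i\<le>d. \<exists>v\<in>V. sees_all_colors c v i)"
proof -
  obtain c' where c': "proper_on V c'" "\<forall>u\<in>S. c' u = c u"
    using proper_on_extend[OF assms(1,2)] by auto
  have "\<exists>v\<in>V. sees_all_colors c' v i" if i: "i \<le> d" for i
  proof -
    obtain v where v: "insert v (N v) \<subseteq> S" "sees_all_colors c v i" using assms(3)[OF i] by auto
    have "c' ` N v = c ` N v" using v(1) c'(2) by (intro image_cong) auto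
    then show ?thesis using v c'(2) assms(1) by (auto simp: sees_all_colors_def intro!: bexI[of _ v])
  qed
  then show ?thesis using c'(1) by blast
qed

section \<open>Unions of rainbow stars\<close>

definition star_union :: "(nat \<Rightarrow> 'a) \<Rightarrow> nat \<Rightarrow> 'a set" where
  "star_union x i = (\<Union>j<i. insert (x j) (N (x j)))"

definition rainbow_stars :: "(nat \<Rightarrow> 'a) \<Rightarrow> nat \<Rightarrow> ('a \<Rightarrow> nat) \<Rightarrow> bool" where
  "rainbow_stars x i c \<longleftrightarrow>
     (\<forall>j<i. x j \<in> V \<and> sees_all_colors c (x j) j) \<and> proper_on (star_union x i) c"

lemma star_union_Suc: "star_union (x(i := v)) (Suc i) = star_union x i \<union> insert v (N v)"
  unfolding star_union_def lessThan_Suc by force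

lemma star_union_subset_V: "rainbow_stars x i c \<Longrightarrow> star_union x i \<subseteq> V"
  using N_subset_V unfolding rainbow_stars_def star_union_def by blast

lemma finite_star_union [simp]: "finite (star_union x i)"
  by (simp add: star_union_def)

text \<open>The new coloring keeps \<open>c\<close> on \<open>S\<close>, gives \<open>v\<close> the
  color \<open>i\<close> and colors the new leaves by \<open>g\<close> with exactly the colors
  \<open>v\<close> still lacks. Clashes of \<open>v\<close> with \<open>S\<close> are excluded by
  \<open>fresh\<close>, those of new leaves with \<open>S\<close> by \<open>avoid\<close>, and those
  between new leaves by injectivity of \<open>g\<close>.\<close>

lemma add_star:
  fixes x c i
  defines "S \<equiv> star_union x i"
  assumes rs: "rainbow_stars x i c" and i: "i \<le> d"
    and v: "v \<in> V" "v \<notin> S"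
    and fresh: "i \<notin> c ` (N v \<inter> S)"
    and g: "bij_betw g (N v - S) ({..d} - {i} - c ` (N v \<inter> S))"
    and avoid: "\<And>y s. y \<in> N v - S \<Longrightarrow> s \<in> S \<Longrightarrow> E y s \<Longrightarrow> g y \<noteq> c s"
  shows "\<exists>c'. rainbow_stars (x(i := v)) (Suc i) c'"
proof -
  define c' where "c' u = (if u \<in> S then c u else if u = v then i else g u)" for u
  have gim: "g ` (N v - S) = {..d} - {i} - c ` (N v \<inter> S)" and ginj: "inj_on g (N v - S)"
    using g by (auto simp: bij_betw_def)
  have gy: "g y \<le> d" "g y \<noteq> i" if "E v y" "y \<notin> S" for y
  proof -
    have "g y \<in> g ` (N v - S)" using that by auto
    then show "g y \<le> d" "g y \<noteq> i" unfolding gim by auto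
  qed
  have proper: "proper_on S c" and old: "\<And>j. j < i \<Longrightarrow> x j \<in> V \<and> sees_all_colors c (x j) j"
    using rs by (auto simp: rainbow_stars_def S_def)
  have img: "c' ` N v = {..d} - {i}"
  proof -
    have "N v = (N v \<inter> S) \<union> (N v - S)" by auto
    then have "c' ` N v = c' ` (N v \<inter> S) \<union> c' ` (N v - S)" by (metis image_Un)
    also have "c' ` (N v \<inter> S) = c ` (N v \<inter> S)" by (intro image_cong) (auto simp: c'_def)
    also have "c' ` (N v - S) = g ` (N v - S)"
      using E_irrefl by (intro image_cong) (auto simp: c'_def)
    also have "c ` (N v \<inter> S) \<subseteq> {..d} - {i}"
      using fresh proper by (auto simp: proper_on_def)
    then have "c ` (N v \<inter> S) \<union> g ` (N v - S) = {..d} - {i}" unfolding gim by auto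
    finally show ?thesis .
  qed
  have "sees_all_colors c' (x j) j" if "j < i" for j
  proof -
    have sub: "insert (x j) (N (x j)) \<subseteq> S" using that by (auto simp: S_def star_union_def)
    have "c' ` N (x j) = c ` N (x j)" using sub by (intro image_cong) (auto simp: c'_def)
    then show ?thesis using old[OF that] sub by (auto simp: sees_all_colors_def c'_def)
  qed
  moreover have "sees_all_colors c' v i" using img v by (simp add: sees_all_colors_def c'_def)
  moreover have "proper_on (S \<union> insert v (N v)) c'"
  proof -
    have le: "c' u \<le> d" if "u \<in> S \<union> insert v (N v)" for u
      using that proper gy i by (auto simp: c'_def proper_on_def)
    \<comment> \<open>The last condition holds for at least one orientation of every edge; the other
      orientation follows by symmetry.\<close>
    have ne: "c' u \<noteq> c' w" if "u \<in> S \<union> insert v (N v)" "w \<in> S \<union> insert v (N v)" "E u w"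
      "w \<in> S \<or> w \<noteq> v \<and> (u \<notin> S)" for u w
    proof (cases "u \<in> S")
      case True
      then show ?thesis using that proper by (auto simp: c'_def proper_on_def)
    next
      case uS: False
      show ?thesis
      proof (cases "u = v")
        case True
        then show ?thesis using that uS fresh gy[of w] by (auto simp: c'_def image_iff)
      next
        case False
        then have u: "u \<in> N v - S" using that uS by auto
        show ?thesis
        proof (cases "w \<in> S")
          case True
          then show ?thesis using avoid[OF u True] that uS False by (auto simp: c'_def)
        next
          case wS: False
          then have "w \<in> N v - S" "w \<noteq> v" using that by auto
          moreover have "u \<noteq> w" using that E_irrefl by auto
          ultimately show ?thesis using ginj u False by (auto simp: c'_def inj_on_def)
        qed
      qed
    qed
    have "c' u \<noteq> c' w" if "u \<in> S \<union> insert v (N v)" "w \<in> S \<union> insert v (N v)" "E u w" for u w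
    proof (cases "w \<in> S \<or> w \<noteq> v \<and> u \<notin> S")
      case True
      then show ?thesis using ne that by blast
    next
      case False
      have "u \<noteq> v" if "w = v" using that \<open>E u w\<close> E_irrefl by auto
      then show ?thesis using ne[of w u] that False E_sym by metis
    qed
    then show ?thesis using le by (auto simp: proper_on_def)
  qed
  ultimately have "rainbow_stars (x(i := v)) (Suc i) c'"
    using old v by (auto simp: rainbow_stars_def star_union_Suc S_def[symmetric] less_Suc_eq)
  then show ?thesis by blast
qed

section \<open>Choosing the next star by counting\<close>

context
  fixes x :: "nat \<Rightarrow> 'a" and i :: nat and c :: "'a \<Rightarrow> nat"
  assumes rs: "rainbow_stars x i c" and i_le: "i \<le> d"
begin

abbreviation "S \<equiv> star_union x i"
definition "leaves = (\<Union>j<i. N (x j))"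

lemma leaves_subset: "leaves \<subseteq> S"
  by (auto simp: star_union_def leaves_def)

lemma S_subset_V: "S \<subseteq> V"
  using rs by (rule star_union_subset_V)

lemma finite_leaves [simp]: "finite leaves"
  by (simp add: leaves_def)

text \<open>All neighbors of a center lie in \<open>S\<close>, so an edge leaving \<open>S\<close>
  cannot start at a center.\<close>

lemma neighbor_in_leaves: "y \<notin> S \<Longrightarrow> E y s \<Longrightarrow> s \<in> S \<Longrightarrow> s \<in> leaves"
  using E_sym by (auto simp: star_union_def leaves_def)

text \<open>The \<open>d\<close> neighbors of a center are mapped onto \<open>d\<close>
  colors.\<close>

lemma inj_on_star: "j < i \<Longrightarrow> inj_on c (N (x j))"
proof (rule eq_card_imp_inj_on)
  assume "j < i"
  then have "x j \<in> V" "c ` N (x j) = {..d} - {j}"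
    using rs by (auto simp: rainbow_stars_def sees_all_colors_def)
  then show "card (c ` N (x j)) = card (N (x j))" using \<open>j < i\<close> i_le by (simp add: card_N)
qed simp

lemma star_color: "j < i \<Longrightarrow> s \<in> N (x j) \<Longrightarrow> c s \<le> d \<and> c s \<noteq> j"
proof -
  assume "j < i" and s: "s \<in> N (x j)"
  then have "c ` N (x j) = {..d} - {j}" using rs by (auto simp: rainbow_stars_def sees_all_colors_def)
  then show ?thesis using s by blast
qed

text \<open>Each star has at most one leaf of color \<open>k\<close>, and the star whose center has
  color \<open>k\<close> has none. This exception is what keeps the bound below \<open>d\<close>
  when \<open>i = d\<close> and \<open>k < d\<close>.\<close>

lemma card_leaves_color: "card {s \<in> leaves. c s = k} \<le> card ({..<i} - {k})"
proof -
  have "{s \<in> leaves. c s = k} \<subseteq> (\<Union>j\<in>{..<i} - {k}. {s \<in> N (x j). c s = k})"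
    using star_color by (auto simp: leaves_def)
  then have "card {s \<in> leaves. c s = k} \<le> card (\<Union>j\<in>{..<i} - {k}. {s \<in> N (x j). c s = k})"
    by (intro card_mono) auto
  also have "\<dots> \<le> (\<Sum>j\<in>{..<i} - {k}. card {s \<in> N (x j). c s = k})"
    by (intro card_UN_le) auto
  also have "\<dots> \<le> (\<Sum>j\<in>{..<i} - {k}. 1)"
  proof (intro sum_mono)
    fix j assume "j \<in> {..<i} - {k}"
    then show "card {s \<in> N (x j). c s = k} \<le> 1"
      using inj_on_star[of j] by (auto simp: card_le_Suc0_iff_eq inj_on_def)
  qed
  finally show ?thesis by simp
qed

text \<open>The leaves of \<open>x j\<close> have distinct colors, and excluding \<open>i\<close>
  and \<open>j\<close> leaves \<open>d - 1\<close> of them.\<close>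

lemma card_leaves_not_color_i: "card {s \<in> leaves. c s \<noteq> i} \<le> i * (d - 1)"
proof -
  have "{s \<in> leaves. c s \<noteq> i} = (\<Union>j<i. {s \<in> N (x j). c s \<noteq> i})"
    by (auto simp: leaves_def)
  also have "card \<dots> \<le> (\<Sum>j<i. card {s \<in> N (x j). c s \<noteq> i})"
    by (intro card_UN_le) auto
  also have "\<dots> \<le> (\<Sum>j<i. d - 1)"
  proof (intro sum_mono)
    fix j assume j: "j \<in> {..<i}"
    let ?A = "{s \<in> N (x j). c s \<noteq> i}"
    have "inj_on c ?A" using inj_on_star[of j] j by (auto simp: inj_on_def)
    then have "card ?A = card (c ` ?A)" by (simp add: card_image)
    also have "c ` ?A \<subseteq> {..d} - {i, j}" using star_color j by auto
    then have "card (c ` ?A) \<le> card ({..d} - {i, j})" by (intro card_mono) auto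
    also have "\<dots> = d - 1" using j i_le by (subst card_Diff_subset) auto
    finally show "card ?A \<le> d - 1" .
  qed
  finally show ?thesis by simp
qed

lemma card_N_leaf_outside: "s \<in> leaves \<Longrightarrow> card (N s - S) \<le> d - 1"
proof -
  assume s: "s \<in> leaves"
  then obtain j where j: "j < i" "E (x j) s" by (auto simp: leaves_def)
  then have "N s - S \<subseteq> N s - {x j}" by (auto simp: star_union_def)
  then have "card (N s - S) \<le> card (N s - {x j})" by (intro card_mono) auto
  also have "\<dots> = d - 1" using E_sym[OF j(2)] E_in_V[OF E_sym[OF j(2)]] card_N[of s] by simp
  finally show ?thesis .
qed

text \<open>Averaging over the set \<open>X\<close> of outside vertices without a neighbor of color
  \<open>i\<close>. At most \<open>i\<close> leaves have color \<open>i\<close>, each with at most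
  \<open>d - 1\<close> outside neighbors; so \<open>X\<close> has more than
  \<open>i * (d - 1) * (d - 1)\<close> elements, while at most that many edges join \<open>P\<close>
  to the outside.\<close>

lemma light_vertex:
  assumes d: "d \<ge> 2"
    and large: "card V > card S + i * (d - 1) + i * (d - 1) * (d - 1)"
  defines "P \<equiv> {s \<in> leaves. c s \<noteq> i}"
  obtains v where "v \<in> V - S" "i \<notin> c ` (N v \<inter> S)"
    "(d - 1) * card (N v \<inter> P) + (\<Sum>y\<in>N v - S. card (N y \<inter> P)) < 2 * (d - 1)"
proof -
  define Out where "Out = V - S"
  define Z where "Z = {s \<in> leaves. c s = i}"
  define X where "X = {v \<in> Out. N v \<inter> Z = {}}"
  define p where "p y = card (N y \<inter> P)" for y
  have fin: "finite Out" "finite X" "finite P" "finite Z"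
    using finite_V by (auto simp: Out_def X_def P_def Z_def)
  have PS: "P \<subseteq> S" and ZS: "Z \<subseteq> leaves"
    using leaves_subset by (auto simp: P_def Z_def)
  have NOut: "N v \<inter> Out = N v - S" for v using N_subset_V by (auto simp: Out_def)
  have "card (Out - X) \<le> card (\<Union>z\<in>Z. N z - S)"
    using fin E_sym by (intro card_mono) (auto simp: X_def Out_def)
  also have "\<dots> \<le> (\<Sum>z\<in>Z. card (N z - S))" using fin by (intro card_UN_le)
  also have "\<dots> \<le> (\<Sum>z\<in>Z. d - 1)" using ZS card_N_leaf_outside by (intro sum_mono) auto
  also have "\<dots> \<le> i * (d - 1)"
  proof -
    have "card Z \<le> i" using card_leaves_color[of i] by (simp add: Z_def)
    then show ?thesis by simp
  qed
  finally have "card (Out - X) \<le> i * (d - 1)" .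
  moreover have "card (Out - X) + card X = card Out"
  proof -
    have "X \<subseteq> Out" by (auto simp: X_def)
    then show ?thesis using fin by (simp add: card_Diff_subset card_mono)
  qed
  moreover have "card Out + card S = card V"
    using S_subset_V finite_V by (simp add: Out_def card_Diff_subset card_mono)
  ultimately have X_large: "card X > i * (d - 1) * (d - 1)" using large by linarith
  have "(\<Sum>y\<in>Out. p y) = (\<Sum>s\<in>P. card (N s \<inter> Out))"
    using sum_card_N[of Out P "\<lambda>_. 1"] fin by (simp add: p_def)
  also have "\<dots> \<le> (\<Sum>s\<in>P. d - 1)"
    unfolding NOut using card_N_leaf_outside by (intro sum_mono) (auto simp: P_def)
  also have "\<dots> \<le> i * (d - 1) * (d - 1)"
    using card_leaves_not_color_i by (simp add: P_def)
  finally have p_le: "(\<Sum>y\<in>Out. p y) < card X" using X_large by linarith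
  \<comment> \<open>The sum is regrouped by the middle vertex \<open>y\<close>. If
    \<open>p y\<close> is nonzero, one of the \<open>d\<close> neighbors of \<open>y\<close> lies in
    \<open>S\<close>, so at most \<open>d - 1\<close> lie in \<open>X\<close>.\<close>
  have "(\<Sum>v\<in>X. \<Sum>y\<in>N v - S. p y) = (\<Sum>y\<in>Out. p y * card (N y \<inter> X))"
    using sum_card_N[of Out X p] fin by (simp add: NOut)
  also have "\<dots> \<le> (\<Sum>y\<in>Out. p y * (d - 1))"
  proof (intro sum_mono)
    fix y assume y: "y \<in> Out"
    show "p y * card (N y \<inter> X) \<le> p y * (d - 1)"
    proof (cases "p y = 0")
      case False
      then obtain s where s: "s \<in> N y \<inter> P" unfolding p_def by (metis card.empty equals0I)
      then have "N y \<inter> X \<subseteq> N y - {s}" using PS by (auto simp: X_def Out_def)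
      then have "card (N y \<inter> X) \<le> card (N y - {s})" by (intro card_mono) auto
      also have "\<dots> = d - 1" using s y card_N[of y] by (simp add: Out_def)
      finally show ?thesis by simp
    qed simp
  qed
  finally have q_le: "(\<Sum>v\<in>X. \<Sum>y\<in>N v - S. p y) \<le> (d - 1) * (\<Sum>y\<in>Out. p y)"
    by (simp add: sum_distrib_right mult.commute)
  have "(\<Sum>v\<in>X. p v) \<le> (\<Sum>y\<in>Out. p y)" using fin by (intro sum_mono2) (auto simp: X_def)
  then have "(d - 1) * (\<Sum>v\<in>X. p v) \<le> (d - 1) * (\<Sum>y\<in>Out. p y)" by simp
  then have "(\<Sum>v\<in>X. (d - 1) * p v + (\<Sum>y\<in>N v - S. p y)) \<le> 2 * (d - 1) * (\<Sum>y\<in>Out. p y)"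
    using add_mono[OF _ q_le]
    by (simp only: sum.distrib sum_distrib_left[symmetric] mult_2 distrib_right)
  also have "\<dots> < 2 * (d - 1) * card X" using p_le d by simp
  finally have total: "(\<Sum>v\<in>X. (d - 1) * p v + (\<Sum>y\<in>N v - S. p y)) < 2 * (d - 1) * card X" .
  have "\<exists>v\<in>X. (d - 1) * p v + (\<Sum>y\<in>N v - S. p y) < 2 * (d - 1)"
  proof (rule ccontr)
    assume "\<not> ?thesis"
    then have "(\<Sum>v\<in>X. 2 * (d - 1)) \<le> (\<Sum>v\<in>X. (d - 1) * p v + (\<Sum>y\<in>N v - S. p y))"
      by (intro sum_mono) (meson not_le)
    then show False using total by (simp add: mult.commute)
  qed
  then obtain v where v: "v \<in> X" "(d - 1) * p v + (\<Sum>y\<in>N v - S. p y) < 2 * (d - 1)" by auto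
  have "i \<notin> c ` (N v \<inter> S)"
  proof
    assume "i \<in> c ` (N v \<inter> S)"
    then obtain s where "s \<in> N v" "s \<in> S" "c s = i" by auto
    moreover from this have "s \<in> leaves" using neighbor_in_leaves[of v s] v(1) by (auto simp: X_def Out_def)
    ultimately show False using v(1) by (auto simp: X_def Z_def)
  qed
  then show ?thesis using that[of v] v by (auto simp: p_def X_def Out_def)
qed

text \<open>The weight bound allows \<open>v\<close> at most one neighbor in \<open>S\<close>. With
  none, fewer than \<open>2 * (d - 1)\<close> conflicts remain for \<open>d\<close> new leaves and
  \<open>bij_avoiding_no_full_line\<close> applies; with one, fewer than \<open>d - 1\<close> remain
  for \<open>d - 1\<close> new leaves and \<open>bij_avoiding_few\<close> applies.\<close>

lemma next_star:
  assumes d: "d \<ge> 2"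
    and large: "card V > card S + i * (d - 1) + i * (d - 1) * (d - 1)"
  shows "\<exists>v c'. v \<in> V \<and> rainbow_stars (x(i := v)) (Suc i) c'"
proof -
  define P where "P = {s \<in> leaves. c s \<noteq> i}"
  obtain v where v: "v \<in> V - S" and fresh: "i \<notin> c ` (N v \<inter> S)"
    and light: "(d - 1) * card (N v \<inter> P) + (\<Sum>y\<in>N v - S. card (N y \<inter> P)) < 2 * (d - 1)"
    using light_vertex[OF d large] unfolding P_def by blast
  define A where "A = N v - S"
  define B where "B = {..d} - {i} - c ` (N v \<inter> S)"
  define R where "R = {(y, k). y \<in> A \<and> k \<in> B \<and> (\<exists>s\<in>S. E y s \<and> c s = k)}"
  have inP: "s \<in> P" if "y \<notin> S" "E y s" "s \<in> S" "c s \<noteq> i" for y s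
    using neighbor_in_leaves[OF that(1-3)] that by (simp add: P_def)
  have fin: "finite A" "finite B" "finite P"
    by (auto simp: A_def B_def P_def)
  have PS: "P \<subseteq> S" using leaves_subset by (auto simp: P_def)
  have NP: "N v \<inter> P = N v \<inter> S"
  proof
    show "N v \<inter> S \<subseteq> N v \<inter> P"
    proof
      fix s assume s: "s \<in> N v \<inter> S"
      then have "c s \<noteq> i" using fresh by blast
      then show "s \<in> N v \<inter> P" using inP[of v s] s v by simp
    qed
  qed (use PS in auto)
  have RAB: "R \<subseteq> A \<times> B" by (auto simp: R_def)
  have R_nbr: "\<exists>s\<in>N y \<inter> P. c s = k" if "(y, k) \<in> R" for y k
    using that inP[of y] by (auto simp: R_def A_def B_def)
  have "R \<subseteq> (\<Union>y\<in>A. (\<lambda>s. (y, c s)) ` (N y \<inter> P))"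
  proof
    fix yk assume "yk \<in> R"
    moreover obtain y k where "yk = (y, k)" by fastforce
    ultimately show "yk \<in> (\<Union>y\<in>A. (\<lambda>s. (y, c s)) ` (N y \<inter> P))"
      using R_nbr[of y k] RAB by auto
  qed
  then have "card R \<le> card (\<Union>y\<in>A. (\<lambda>s. (y, c s)) ` (N y \<inter> P))"
    using fin by (intro card_mono) auto
  also have "\<dots> \<le> (\<Sum>y\<in>A. card ((\<lambda>s. (y, c s)) ` (N y \<inter> P)))" using fin by (intro card_UN_le)
  also have "\<dots> \<le> (\<Sum>y\<in>A. card (N y \<inter> P))" by (intro sum_mono card_image_le) auto
  finally have cardR: "(d - 1) * card (N v \<inter> S) + card R < 2 * (d - 1)"
    using light NP by (simp add: A_def)
  have "card (N v \<inter> S) < 2"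
  proof (rule ccontr)
    assume "\<not> ?thesis"
    then have "(d - 1) * 2 \<le> (d - 1) * card (N v \<inter> S)" by (intro mult_le_mono) auto
    then show False using cardR by linarith
  qed
  then consider "card (N v \<inter> S) = 0" | "card (N v \<inter> S) = 1" by linarith
  then have "\<exists>g. bij_betw g A B \<and> (\<forall>a\<in>A. (a, g a) \<notin> R)"
  proof cases
    case 1
    have "finite (N v \<inter> S)" by (rule finite_Int) simp
    then have empty: "N v \<inter> S = {}" using 1 card_0_eq by blast
    have A: "A = N v" and B: "B = {..d} - {i}" unfolding A_def B_def using empty by (blast, simp)
    have card: "card A = d" "card B = d" unfolding A B using v card_N[of v] i_le by simp_all
    show ?thesis
    proof (rule bij_avoiding_no_full_line[OF fin(1,2) _ RAB])
      show "card A = card B" using card by simp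
      show "card R + 2 < 2 * card A" using cardR card 1 d by simp
    next
      fix y assume y: "y \<in> A"
      then have yV: "y \<in> V" unfolding A using E_in_V2 by simp
      \<comment> \<open>One of the \<open>d\<close> neighbors of \<open>y\<close> is
        \<open>v\<close>, outside \<open>S\<close>, so at most \<open>d - 1\<close> of the
        \<open>d\<close> colors are blocked for \<open>y\<close>.\<close>
      show "\<exists>b\<in>B. (y, b) \<notin> R"
      proof (rule ccontr)
        assume "\<not> ?thesis"
        then have "B \<subseteq> c ` (N y \<inter> P)" using R_nbr by blast
        then have "card B \<le> card (c ` (N y \<inter> P))" by (intro card_mono) auto
        also have "\<dots> \<le> card (N y \<inter> P)" by (intro card_image_le) auto
        also have "N y \<inter> P \<subseteq> N y - {v}" using v PS by auto
        then have "card (N y \<inter> P) \<le> card (N y - {v})" by (intro card_mono) auto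
        also have "\<dots> = d - 1" using y card_N[OF yV] E_sym by (simp add: A)
        finally show False using card d by simp
      qed
    next
      fix k assume k: "k \<in> B"
      \<comment> \<open>A full column would give each of the \<open>d\<close> new leaves a neighbor
        of color \<open>k\<close> among the old leaves. These neighbors differ, since a shared one
        would close a 4-cycle through \<open>v\<close>, but fewer than \<open>d\<close> old leaves
        have color \<open>k\<close>.\<close>
      show "\<exists>a\<in>A. (a, k) \<notin> R"
      proof (rule ccontr)
        assume "\<not> ?thesis"
        then have "\<forall>y\<in>A. \<exists>s. s \<in> N y \<inter> P \<and> c s = k" using R_nbr by blast
        then obtain s where s: "\<And>y. y \<in> A \<Longrightarrow> s y \<in> N y \<inter> P \<and> c (s y) = k" by metis
        have "inj_on s A"
        proof (rule inj_onI)
          fix y y' assume yy: "y \<in> A" "y' \<in> A" "s y = s y'"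
          have "s y \<noteq> v" using s[OF yy(1)] PS v by auto
          then show "y = y'"
            using no_C4[of v y "s y" y'] s[OF yy(1)] s[OF yy(2)] yy by (auto simp: A)
        qed
        then have "card A = card (s ` A)" by (simp add: card_image)
        also have "\<dots> \<le> card {s \<in> leaves. c s = k}"
          using s by (intro card_mono) (auto simp: P_def)
        also have "\<dots> \<le> card ({..<i} - {k})" by (rule card_leaves_color)
        also have "\<dots> < d"
        proof (cases "i = d")
          case True
          then have "k \<in> {..<i}" using k by (auto simp: B)
          then show ?thesis using True d by simp
        next
          case False
          have "card ({..<i} - {k}) \<le> card {..<i}" by (intro card_mono) auto
          then show ?thesis using False i_le by simp
        qed
        finally show False using card by simp
      qed
    qed
  next
    case 2
    then obtain z where z: "N v \<inter> S = {z}" by (meson card_1_singletonE)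
    have zz: "z \<in> N v" "z \<in> S" using z by blast+
    have "A = N v - {z}" unfolding A_def using z by blast
    with zz have cA: "card A = d - 1" using card_N[of v] v by simp
    have "z \<in> leaves" using zz v neighbor_in_leaves[of v z] by simp
    then have "c z \<le> d" using star_color by (auto simp: leaves_def)
    moreover have "c z \<noteq> i" using fresh zz by blast
    moreover have "B = {..d} - {i, c z}" unfolding B_def z by blast
    ultimately have cB: "card B = d - 1" using i_le by (simp add: card_Diff_subset)
    show ?thesis using cardR 2 cA cB by (intro bij_avoiding_few[OF fin(1,2) _ RAB]) auto
  qed
  then obtain g where g: "bij_betw g A B" "\<And>a. a \<in> A \<Longrightarrow> (a, g a) \<notin> R" by blast
  have "g y \<noteq> c s" if y: "y \<in> N v - S" and s: "s \<in> S" "E y s" for y s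
  proof -
    have "g y \<in> B" using g(1) y by (auto simp: bij_betw_def A_def)
    then show ?thesis using g(2)[of y] y s by (auto simp: R_def A_def)
  qed
  then have "\<exists>c'. rainbow_stars (x(i := v)) (Suc i) c'"
    using g(1) v fresh unfolding A_def B_def by (intro add_star[OF rs i_le]) auto
  then show ?thesis using v by auto
qed

end

text \<open>The second center \<open>v\<close> is taken at distance 2 from \<open>v0\<close>, so
  that both stars share the leaf \<open>z\<close>, which saves one vertex.\<close>

lemma second_star:
  assumes d: "d \<ge> 3" and "V \<noteq> {}"
  shows "\<exists>x c. rainbow_stars x 2 c \<and> card (star_union x 2) < 2 * (d + 1)"
proof -
  obtain v0 where v0: "v0 \<in> V" using assms by auto
  have [simp]: "star_union x 0 = {}" for x by (simp add: star_union_def)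
  have "card (N v0) = card ({..d} - {0})" using card_N[OF v0] by simp
  then obtain g where g: "bij_betw g (N v0) ({..d} - {0})"
    using finite_same_card_bij by (metis finite_N finite_Diff finite_atMost)
  \<comment> \<open>Only the values of \<open>x\<close> at indices below the number of stars matter.
    The first star is added to an empty union, where any initial coloring will do.\<close>
  define x where "x = (\<lambda>_::nat. undefined :: 'a)(0 := v0)"
  have "\<exists>c. rainbow_stars x (Suc 0) c"
    unfolding x_def using g v0
    by (intro add_star[where g = g and c = "\<lambda>_. 0"]) (auto simp: rainbow_stars_def proper_on_def)
  then obtain c where c: "rainbow_stars x (Suc 0) c" by auto
  let ?S = "star_union x (Suc 0)"
  have S: "?S = insert v0 (N v0)" by (auto simp: star_union_def x_def)
  have c0: "c v0 = 0" "c ` N v0 = {..d} - {0}"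
    using c by (auto simp: rainbow_stars_def sees_all_colors_def x_def)
  have inj: "inj_on c (N v0)"
    using inj_on_star[OF c, of 0] d by (simp add: x_def)
  \<comment> \<open>The shared leaf is adjacent to centers of colors 0 and 1, so its color is taken
    to be 2.\<close>
  have "2 \<in> c ` N v0" using c0 d by auto
  then obtain z where z: "z \<in> N v0" "c z = 2" by auto
  have zV: "z \<in> V" using z E_in_V2 by simp
  have zv0: "z \<noteq> v0" using z E_irrefl by auto
  \<comment> \<open>In the first star, \<open>z\<close> is adjacent to \<open>v0\<close> and to at
    most one common neighbor with \<open>v0\<close>; a third neighbor exists as
    \<open>d \<ge> 3\<close>.\<close>
  have "N z \<inter> ?S \<subseteq> insert v0 (N z \<inter> N v0)" by (auto simp: S)
  then have "card (N z \<inter> ?S) \<le> card (insert v0 (N z \<inter> N v0))" by (intro card_mono) auto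
  also have "\<dots> \<le> 2" using card_common_N[OF zv0] by (simp add: card_insert_if)
  also have "\<dots> < card (N z)" using card_N[OF zV] d by simp
  finally have "N z \<inter> ?S \<noteq> N z" by auto
  then obtain v where v: "v \<in> N z" "v \<notin> ?S" by blast
  have vV: "v \<in> V" using v E_in_V2 by simp
  have vv0: "v \<noteq> v0" "\<not> E v v0" "\<not> E v0 v" using v S E_sym by auto
  have NvS: "N v \<inter> ?S = {z}"
    using v z vv0 no_C4[of v _ v0 z] E_sym by (auto simp: S)
  define A where "A = N v - ?S"
  define B where "B = {..d} - {Suc 0} - c ` (N v \<inter> ?S)"
  define R where "R = {(y, k). y \<in> A \<and> k \<in> B \<and> (\<exists>s\<in>?S. E y s \<and> c s = k)}"
  have fin: "finite A" "finite B" by (auto simp: A_def B_def)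
  have "A = N v - {z}" using NvS by (auto simp: A_def)
  then have cA: "card A = d - 1" using card_N[OF vV] v E_sym by simp
  have "B = {..d} - {Suc 0, 2}" unfolding B_def NvS using z by auto
  then have cB: "card B = d - 1" using d by (simp add: card_Diff_subset)
  have nbr: "s \<in> N v0" if "y \<in> A" "E y s" "s \<in> ?S" for y s
    using that E_sym by (auto simp: A_def S)
  have "\<exists>g. bij_betw g A B \<and> (\<forall>a\<in>A. (a, g a) \<notin> R)"
  proof (rule bij_avoiding_local[OF fin])
    show "card A = card B" using cA cB by simp
  next
    \<comment> \<open>Rows and columns hold at most one conflict each, and
      \<open>1 + 1 \<le> d - 1\<close>. In a row, \<open>y\<close> and \<open>v0\<close> have at
      most one common neighbor. In a column, color \<open>k\<close> occurs on one leaf of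
      \<open>v0\<close> only, and this leaf and \<open>v\<close> have at most one common
      neighbor.\<close>
    fix y k assume y: "y \<in> A" and k: "k \<in> B"
    have "y \<noteq> v0" using y by (auto simp: A_def S)
    have "card {k' \<in> B. (y, k') \<in> R} \<le> 1"
    proof -
      have "{k' \<in> B. (y, k') \<in> R} \<subseteq> c ` (N y \<inter> N v0)"
        using nbr y by (auto simp: R_def)
      then have "card {k' \<in> B. (y, k') \<in> R} \<le> card (c ` (N y \<inter> N v0))" by (intro card_mono) auto
      also have "\<dots> \<le> card (N y \<inter> N v0)" by (intro card_image_le) auto
      finally show ?thesis using card_common_N[OF \<open>y \<noteq> v0\<close>] by simp
    qed
    moreover have "card {y' \<in> A. (y', k) \<in> R} \<le> 1"
    proof -
      have "y1 = y2" if yy: "y1 \<in> A" "y2 \<in> A" "(y1, k) \<in> R" "(y2, k) \<in> R" for y1 y2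
      proof -
        obtain s1 where s1: "s1 \<in> ?S" "E y1 s1" "c s1 = k" using yy(3) unfolding R_def by blast
        obtain s2 where s2: "s2 \<in> ?S" "E y2 s2" "c s2 = k" using yy(4) unfolding R_def by blast
        have "s1 = s2"
          using inj_onD[OF inj, of s1 s2] nbr[OF yy(1) s1(2,1)] nbr[OF yy(2) s2(2,1)] s1 s2 by simp
        moreover have "s1 \<noteq> v" using s1 v by auto
        ultimately show ?thesis using no_C4[of v y1 s1 y2] s1 s2 yy by (simp add: A_def)
      qed
      then show ?thesis using fin by (auto simp: card_le_Suc0_iff_eq)
    qed
    ultimately show "card {k' \<in> B. (y, k') \<in> R} + card {y' \<in> A. (y', k) \<in> R} \<le> card A"
      using cA d by linarith
  qed
  then obtain g' where g': "bij_betw g' A B" "\<And>a. a \<in> A \<Longrightarrow> (a, g' a) \<notin> R" by blast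
  have "g' y \<noteq> c s" if y: "y \<in> N v - ?S" and s: "s \<in> ?S" "E y s" for y s
  proof -
    have "g' y \<in> B" using g'(1) y by (auto simp: bij_betw_def A_def)
    then show ?thesis using g'(2)[of y] y s by (auto simp: R_def A_def)
  qed
  then have "\<exists>c'. rainbow_stars (x(Suc 0 := v)) (Suc (Suc 0)) c'"
    using g'(1) v vV d NvS z unfolding A_def B_def by (intro add_star[OF c]) auto
  moreover have "card (star_union (x(Suc 0 := v)) 2) < 2 * (d + 1)"
  proof -
    have "star_union (x(Suc 0 := v)) 2 = insert v0 (insert v (N v0 \<union> (N v - {z})))"
      using star_union_Suc[of x "Suc 0" v] z unfolding S by (auto simp: numeral_2_eq_2)
    moreover have "card (N v0 \<union> (N v - {z})) \<le> d + (d - 1)"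
      using card_Un_le[of "N v0" "N v - {z}"] card_N v0 vV v E_sym by simp
    moreover have "card (insert v0 (insert v M)) \<le> Suc (Suc (card M))" if "finite M" for M
      using that by (simp add: card_insert_if)
    from this[of "N v0 \<union> (N v - {z})"] calculation show ?thesis using d by simp
  qed
  ultimately show ?thesis unfolding numeral_2_eq_2 by blast
qed

text \<open>The strict bound carries the vertex saved by \<open>second_star\<close> through the
  induction. In the step \<open>i = d\<close> the count reaches exactly \<open>d ^ 3 + d\<close>, so
  this saving provides the strict inequality that \<open>next_star\<close> requires.\<close>

lemma all_stars:
  assumes d: "d \<ge> 3" and large: "card V \<ge> d ^ 3 + d" and i: "2 \<le> i" "i \<le> d + 1"
  shows "\<exists>x c. rainbow_stars x i c \<and> card (star_union x i) < i * (d + 1)"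
  using i
proof (induction i rule: dec_induct)
  case base
  have "V \<noteq> {}" using large d by auto
  then show ?case using second_star d by simp
next
  case (step i)
  then obtain x c where xc: "rainbow_stars x i c" "card (star_union x i) < i * (d + 1)" by auto
  have i_le: "i \<le> d" using step by simp
  have "i * (d + 1) + i * (d - 1) + i * (d - 1) * (d - 1) \<le> d ^ 3 + d"
  proof -
    \<comment> \<open>Writing \<open>d\<close> as a successor removes the truncated subtractions
      before the algebra.\<close>
    obtain e where e: "d = Suc e" using d by (cases d) auto
    have "i * (d + 1) + i * (d - 1) + i * (d - 1) * (d - 1) = i * (d * d + 1)"
      unfolding e by (simp add: algebra_simps)
    also have "\<dots> \<le> d * (d * d + 1)" using i_le by (rule mult_le_mono1)
    finally show ?thesis by (simp add: power3_eq_cube algebra_simps)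
  qed
  then have "card V > card (star_union x i) + i * (d - 1) + i * (d - 1) * (d - 1)"
    using xc(2) large by linarith
  then obtain v c' where v: "v \<in> V" "rainbow_stars (x(i := v)) (Suc i) c'"
    using next_star[OF xc(1) i_le] d by auto
  have "card (star_union (x(i := v)) (Suc i)) \<le> card (star_union x i) + card (insert v (N v))"
    unfolding star_union_Suc by (rule card_Un_le)
  also have "card (insert v (N v)) \<le> d + 1"
    using card_N[OF v(1)] by (simp add: card_insert_if)
  finally have "card (star_union (x(i := v)) (Suc i)) < Suc i * (d + 1)" using xc(2) by simp
  then show ?case using v(2) by blast
qed

section \<open>Degrees 1 and 2\<close>

lemma b_coloring_small_degree:
  assumes d: "d = 1 \<or> d = 2" and v: "v \<in> V"
  shows "\<exists>c. proper_on V c \<and> (\<forall>i\<le>d. \<exists>v\<in>V. sees_all_colors c v i)"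
proof (cases "d = 1")
  case True
  then obtain w where w: "N v = {w}" using card_N[OF v] by (metis card_1_singletonE)
  have wV: "w \<in> V" using w N_subset_V[of v] by simp
  have "E v w" using w by (metis mem_N singletonI)
  then have "v \<in> N w" using E_sym by simp
  then have w': "N w = {v}" using card_N[OF wV] True by (metis card_1_singletonE singletonD)
  have "v \<noteq> w" using \<open>E v w\<close> E_irrefl by metis
  let ?c = "\<lambda>u. if u = v then 0 else 1 :: nat"
  show ?thesis
  proof (rule b_coloring_of_partial)
    show "{v, w} \<subseteq> V" using v wV by simp
    show "proper_on {v, w} ?c" unfolding proper_on_def unfolding True using E_irrefl by auto
    fix i assume "i \<le> d"
    then consider "i = 0" | "i = 1" using True by linarith
    then show "\<exists>u. insert u (N u) \<subseteq> {v, w} \<and> sees_all_colors ?c u i"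
    proof cases
      case 1
      have "sees_all_colors ?c v i"
        unfolding sees_all_colors_def w 1 unfolding True using \<open>v \<noteq> w\<close> by auto
      then show ?thesis using w by blast
    next
      case 2
      have "sees_all_colors ?c w i"
        unfolding sees_all_colors_def w' 2 unfolding True using \<open>v \<noteq> w\<close> by auto
      then show ?thesis using w' by blast
    qed
  qed
next
  case False
  then have d2: "d = 2" using d by blast
  have nbrs: "\<exists>b. b \<noteq> a \<and> N u = {a, b}" if "E u a" for u a
  proof -
    have "card (N u - {a}) = 1"
      using card_N[OF E_in_V[OF that]] that by (simp add: d2)
    then obtain b where "N u - {a} = {b}" by (metis card_1_singletonE)
    moreover have "a \<in> N u" using that by simp
    ultimately show ?thesis by blast
  qed
  \<comment> \<open>Walk along the cycle through \<open>v\<close>: the vertices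
    \<open>b, v, a, e, f\<close> get the colors 2, 0, 1, 2, 0, so that \<open>v\<close>,
    \<open>a\<close> and \<open>e\<close> dominate. Absence of 4-cycles gives
    \<open>b \<noteq> f\<close>. In a triangle, \<open>b = e\<close> and \<open>f = v\<close>, which
    agrees with these colors.\<close>
  have "card (N v) = 2" using card_N[OF v] d2 by simp
  then obtain a where va: "E v a" by (metis card.empty equals0I mem_N zero_neq_numeral)
  obtain b where b: "b \<noteq> a" "N v = {a, b}" using nbrs[OF va] by auto
  obtain e where e: "e \<noteq> v" "N a = {v, e}" using nbrs[of a v] va E_sym by auto
  have ae: "E a e" using e(2) by (metis insertCI mem_N)
  obtain f where f: "f \<noteq> a" "N e = {a, f}" using nbrs[of e a] ae E_sym by auto
  have vb: "E v b" using b(2) by (metis insertCI mem_N)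
  have ef: "E e f" using f(2) by (metis insertCI mem_N)
  have distinct: "v \<noteq> a" "v \<noteq> b" "a \<noteq> e" "e \<noteq> f" using va vb ae ef E_irrefl by auto
  have "b \<noteq> f" using no_C4[of v a e b] va ae vb ef E_sym b(1) e(1) by auto
  let ?c = "\<lambda>u. if u = v \<or> u = f then 0 else if u = a then 1 else 2 :: nat"
  have Nv: "E v u \<longleftrightarrow> u = a \<or> u = b" and Ne: "E e u \<longleftrightarrow> u = a \<or> u = f" for u
    unfolding mem_N[symmetric] b(2) f(2) by simp_all
  have nonadj: "\<not> E v f" "\<not> E e b" using Nv Ne \<open>b \<noteq> f\<close> b(1) f(1) by simp_all
  then have nonadj': "\<not> E f v" "\<not> E b e" using E_sym[of f v] E_sym[of b e] by blast+
  show ?thesis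
  proof (rule b_coloring_of_partial)
    show "{v, a, b, e, f} \<subseteq> V" using v va vb ae ef E_in_V E_sym by blast
    show "proper_on {v, a, b, e, f} ?c"
      unfolding proper_on_def unfolding d2
    proof (intro conjI ballI impI)
      fix u w assume "u \<in> {v, a, b, e, f}" "w \<in> {v, a, b, e, f}" "E u w"
      moreover have "\<not> E y y" for y by (rule E_irrefl)
      moreover have "u \<in> {v, f} \<and> w \<in> {v, f} \<or> u = a \<and> w = a \<or> u \<in> {b, e} \<and> w \<in> {b, e}"
        if "?c u = ?c w"
        using that calculation(1,2) by (simp split: if_splits) blast+
      ultimately show "?c u \<noteq> ?c w" using nonadj nonadj' by blast
    qed auto
    fix i assume "i \<le> d"
    then consider "i = 0" | "i = 1" | "i = 2" using d2 by linarith
    then show "\<exists>u. insert u (N u) \<subseteq> {v, a, b, e, f} \<and> sees_all_colors ?c u i"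
    proof cases
      case 1
      have "sees_all_colors ?c v i" unfolding sees_all_colors_def b(2) 1 unfolding d2
        using distinct b(1) f(1) \<open>b \<noteq> f\<close> by auto
      then show ?thesis using b(2) by blast
    next
      case 2
      have "sees_all_colors ?c a i" unfolding sees_all_colors_def e(2) 2 unfolding d2
        using distinct e(1) f(1) by auto
      then show ?thesis using e(2) by blast
    next
      case 3
      have "sees_all_colors ?c e i" unfolding sees_all_colors_def f(2) 3 unfolding d2
        using distinct e(1) f(1) by auto
      then show ?thesis using f(2) by blast
    qed
  qed
qed

lemma exists_b_coloring:
  assumes "d \<ge> 1" and large: "card V \<ge> d ^ 3 + d"
  shows "\<exists>c. proper_on V c \<and> (\<forall>i\<le>d. \<exists>v\<in>V. sees_all_colors c v i)"
proof (cases "d \<ge> 3")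
  case True
  then obtain x c where x: "rainbow_stars x (d + 1) c"
    using all_stars[OF True large, of "d + 1"] by auto
  show ?thesis
  proof (rule b_coloring_of_partial[OF star_union_subset_V[OF x]])
    show "proper_on (star_union x (d + 1)) c" using x by (simp add: rainbow_stars_def)
    fix i assume "i \<le> d"
    then have "i < d + 1" by simp
    then show "\<exists>v. insert v (N v) \<subseteq> star_union x (d + 1) \<and> sees_all_colors c v i"
      using x unfolding rainbow_stars_def star_union_def by (intro exI[of _ "x i"]) blast
  qed
next
  case False
  have "V \<noteq> {}" using assms by auto
  then obtain v where "v \<in> V" by auto
  moreover have "d = 1 \<or> d = 2" using False assms(1) by linarith
  ultimately show ?thesis by (intro b_coloring_small_degree)
qed

end

subsection \<open>Graphs as symmetric digraphs\<close>

text \<open>A dominant vertex of color 0 has neighbors of all \<open>k - 1\<close> other colors,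
  hence \<open>k - 1 \<le> d\<close>.\<close>

lemma b_coloring_le:
  assumes "graph G" "regular d G" "b_coloring G k c"
  shows "k \<le> d + 1"
proof (cases "k = 0")
  case False
  interpret graph G by fact
  obtain v where v: "v \<in> color_class G c 0" "dominant G k c v"
    using assms(3) False by (auto simp: b_coloring_def)
  have "{1..<k} \<subseteq> (c \<circ> head G) ` out_arcs G v"
  proof
    fix j assume j: "j \<in> {1..<k}"
    have "c v = 0" using v(1) by (simp add: color_class_def)
    then obtain w where w: "c w = j" "v \<rightarrow>\<^bsub>G\<^esub> w"
      using v(2) j by (fastforce simp: dominant_def color_class_def)
    then obtain e where "e \<in> arcs G" "tail G e = v" "head G e = w" by (auto simp: arcs_ends_conv)
    then show "j \<in> (c \<circ> head G) ` out_arcs G v" using w(1) by (intro image_eqI[of _ _ e]) auto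
  qed
  then have "card {1..<k} \<le> card (out_arcs G v)"
    by (meson card_image_le card_mono finite_imageI finite_out_arcs le_trans)
  also have "\<dots> = d"
    using v(1) assms(2) by (simp add: regular_def out_degree_def color_class_def)
  finally show ?thesis by simp
qed simp

lemma (in graph) cycle_of_length_4:
  assumes "u \<rightarrow>\<^bsub>G\<^esub> a" "a \<rightarrow>\<^bsub>G\<^esub> v" "v \<rightarrow>\<^bsub>G\<^esub> b" "b \<rightarrow>\<^bsub>G\<^esub> u" "u \<noteq> v" "a \<noteq> b"
  shows "has_cycle_of_length 4 G"
proof -
  obtain e1 where e1: "e1 \<in> arcs G" "tail G e1 = u" "head G e1 = a"
    using assms(1) by (auto simp: arcs_ends_conv)
  obtain e2 where e2: "e2 \<in> arcs G" "tail G e2 = a" "head G e2 = v"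
    using assms(2) by (auto simp: arcs_ends_conv)
  obtain e3 where e3: "e3 \<in> arcs G" "tail G e3 = v" "head G e3 = b"
    using assms(3) by (auto simp: arcs_ends_conv)
  obtain e4 where e4: "e4 \<in> arcs G" "tail G e4 = b" "head G e4 = u"
    using assms(4) by (auto simp: arcs_ends_conv)
  have "a \<noteq> v" "v \<noteq> b" "b \<noteq> u" "u \<noteq> a" using assms adj_not_same by auto
  then have "cycle [e1, e2, e3, e4]"
    using e1 e2 e3 e4 assms(5,6) unfolding cycle_def awalk_def by (intro exI[of _ u]) auto
  then show ?thesis unfolding has_cycle_of_length_def by (intro exI[of _ "[e1, e2, e3, e4]"]) simp
qed

lemma c4_free_regular_graph:
  assumes "graph G" "regular d G" "\<not> has_cycle_of_length 4 G"
  shows "c4_free_regular (verts G) (\<lambda>u v. u \<rightarrow>\<^bsub>G\<^esub> v) d"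
proof -
  interpret graph G by fact
  show ?thesis
  proof
    show "finite (verts G)" by simp
    show "u \<in> verts G" if "u \<rightarrow>\<^bsub>G\<^esub> v" for u v using that by auto
    show "v \<rightarrow>\<^bsub>G\<^esub> u" if "u \<rightarrow>\<^bsub>G\<^esub> v" for u v using that by (rule graph_symmetric)
    show "\<not> v \<rightarrow>\<^bsub>G\<^esub> v" for v using adj_not_same by blast
    show "a = b" if "u \<rightarrow>\<^bsub>G\<^esub> a" "a \<rightarrow>\<^bsub>G\<^esub> v" "u \<rightarrow>\<^bsub>G\<^esub> b" "b \<rightarrow>\<^bsub>G\<^esub> v" "u \<noteq> v" for u v a b
      using cycle_of_length_4[of u a v b] that assms(3) graph_symmetric by blast
    show "card {w. v \<rightarrow>\<^bsub>G\<^esub> w} = d" if "v \<in> verts G" for v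
    proof -
      \<comment> \<open>Without parallel arcs, the arcs leaving \<open>v\<close> correspond to its
        neighbors, so the out-degree counts neighbors.\<close>
      have "inj_on (head G) (out_arcs G v)"
        using no_multi_arcs by (auto simp: inj_on_def arc_to_ends_def)
      moreover have "{w. v \<rightarrow>\<^bsub>G\<^esub> w} = head G ` out_arcs G v"
        by (auto simp: arcs_ends_conv image_iff)
      ultimately show ?thesis
        using that assms(2) by (simp add: card_image regular_def out_degree_def)
    qed
  qed
qed

theorem theorem2p1:
  fixes G :: "('a, 'b) pre_digraph" and d :: nat
  assumes "d \<ge> 1"
    and "graph G"
    and "regular d G"
    and "\<not> has_cycle_of_length 4 G"
    and "card (verts G) \<ge> d ^ 3 + d"
  shows "b_chromatic_number G = d + 1"
proof -
  interpret c4_free_regular "verts G" "\<lambda>u v. u \<rightarrow>\<^bsub>G\<^esub> v" d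
    using assms by (intro c4_free_regular_graph)
  obtain c where proper: "proper_on (verts G) c"
    and dom: "\<And>i. i \<le> d \<Longrightarrow> \<exists>v\<in>verts G. sees_all_colors c v i"
    using exists_b_coloring[OF assms(1,5)] by blast
  \<comment> \<open>The colors \<open>0, ..., d\<close> of the locale are the colors below
    \<open>d + 1\<close> here.\<close>
  have "proper_coloring G (d + 1) c"
    using proper E_in_V E_in_V2 by (auto simp: proper_coloring_def proper_on_def less_Suc_eq_le)
  moreover have "\<exists>v\<in>color_class G c i. dominant G (d + 1) c v" if i: "i < d + 1" for i
  proof -
    obtain v where v: "v \<in> verts G" "sees_all_colors c v i" using dom[of i] i by auto
    have "\<exists>w\<in>color_class G c j. v \<rightarrow>\<^bsub>G\<^esub> w" if j: "j < d + 1" "j \<noteq> i" for j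
    proof -
      have "j \<in> c ` N v" using v(2) j by (auto simp: sees_all_colors_def)
      then obtain w where w: "c w = j" "v \<rightarrow>\<^bsub>G\<^esub> w" by auto
      then have "w \<in> verts G" by (intro E_in_V2)
      then show ?thesis using w by (intro bexI[of _ w]) (simp_all add: color_class_def)
    qed
    then show ?thesis using v
      by (intro bexI[of _ v]) (auto simp: dominant_def sees_all_colors_def color_class_def)
  qed
  ultimately have "b_coloring G (d + 1) c" by (simp add: b_coloring_def)
  then show ?thesis unfolding b_chromatic_number_def
    using b_coloring_le[OF assms(2,3)] by (intro Greatest_equality) auto
qed

end
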